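(* Let $X$ be a nonempty set, let $\overline{X}=X\cup\{\mathbf 0\}$, let $d$ be an ultra-pseudometric on $\overline{X}$, and let $\mathbb F$ be a non-archimedean valued field. Then: (1) There exists a Kantorovich ultra-seminorm $\|\cdot\|=\|\cdot\|_d$ on $L_{\mathbb F}(X)$ for $d$. Furthermore, if $d$ is an ultra-metric then $\|\cdot\|_d$ is an ultra-norm. (2) For every $u\in L_{\mathbb F}(X)$, $\|u\|$ can be computed on the support of $u$: $$\|u\|=\inf\Big\{\max_{1\le i\le k}|s_i|\,d(x_i,y_i)\;:\; u=\sum_{i=1}^k s_i(x_i-y_i),\ x_i,y_i\in \operatorname{supp}(u),\ s_i\in\mathbb F\Big\}.$$ (3) Moreover, if $u=\sum_{i=1}^n\lambda_i x_i$ is a normal form of $u$, $m=|\operatorname{supp}(u)|$ and $\operatorname{supp}(u)=\{x_1,\dots,x_m\}$, then $$\|u\|=\inf\Big\{\max_{1\le i,j\le m}|c_{ij}|\,d(x_i,x_j)\;:\; c_{ij}\in\mathbb F,\ \sum_{j=1}^m c_{ij}-\sum_{j=1}^m c_{ji}=\lambda_i\ \text{ for all } 1\le i\le n\Big\},$$ where $c_{ii}=0_{\mathbb F}$ for all $i$.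
   Context: $L_{\mathbb F}(X)$ is the free $\mathbb F$-vector space on the nonempty set $X$; $\mathbf 0\notin X$ is its zero vector and $\overline X:=X\cup\{\mathbf 0\}\subseteq L_{\mathbb F}(X)$. $L^0_{\mathbb F}(X)$ is the kernel of the functional $\sum\lambda_ix_i\mapsto\sum\lambda_i$. Normal form and support: every nonzero $u\in L_{\mathbb F}(X)$ is written $u=\sum_{i=1}^n\lambda_ix_i$ with the $x_i\in X$ pairwise distinct and all $\lambda_i\ne 0_{\mathbb F}$. If $u\in L^0_{\mathbb F}(X)$, $\operatorname{supp}(u):=\{x_1,\dots,x_n\}$ (so $m=|\operatorname{supp}(u)|=n$); otherwise $\operatorname{supp}(u):=\{x_1,\dots,x_n,x_{n+1}\}$ with $x_{n+1}=\mathbf 0$ (so $m=n+1$). $\operatorname{supp}(\mathbf 0):=\{\mathbf 0\}$. A non-archimedean valued field is a field with a valuation $|\cdot|:\mathbb F\to[0,\infty)$ with $|x|=0\iff x=0$, $|xy|=|x||y|$, $|x+y|\le\max\{|x|,|y|\}$ (the trivial valuation is allowed). An ultra-pseudometric is a pseudometric with $d(x,z)\le\max\{d(x,y),d(y,z)\}$; it is an ultra-metric if it is a metric. An ultra-seminorm on an $\mathbb F$-vector space $V$ is a map $p:V\to[0,\infty)$ with $p(0)=0$, $p(x+y)\le\max\{p(x),p(y)\}$, $p(\alpha x)=|\alpha|p(x)$; it is an ultra-norm if $p(x)=0$ only for $x=0$. An ultra-seminorm $p$ on $L_{\mathbb F}(X)$ is $d$-compatible if $p(x-y)=d(x,y)$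 for all $x,y\in\overline X$. A Kantorovich ultra-seminorm for $d$ is the maximal $d$-compatible ultra-seminorm on $L_{\mathbb F}(X)$, i.e. a $d$-compatible ultra-seminorm $p$ with $q\le p$ pointwise for every $d$-compatible ultra-seminorm $q$. *)

theory Defs
  imports Complex_Main "HOL-Library.Poly_Mapping"
begin

text \<open>The set \<open>X\<close> is the universe of the type variable \<open>'x\<close>, and the free vector space on it
  is the type \<open>'x \<Rightarrow>\<^sub>0 'f\<close> of finitely supported functions, for a field \<open>'f\<close>.\<close>

definition scale :: "'f::field \<Rightarrow> ('x \<Rightarrow>\<^sub>0 'f) \<Rightarrow> ('x \<Rightarrow>\<^sub>0 'f)" where
  "scale a u = Poly_Mapping.map ((*) a) u"

definition gen :: "'x \<Rightarrow> ('x \<Rightarrow>\<^sub>0 'f::field)" where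
  "gen x = Poly_Mapping.single x 1"

definition Xbar :: "('x \<Rightarrow>\<^sub>0 'f::field) set" where
  "Xbar = insert 0 (range gen)"

definition coeff_sum :: "('x \<Rightarrow>\<^sub>0 'f::field) \<Rightarrow> 'f" where
  "coeff_sum u = (\<Sum>x\<in>Poly_Mapping.keys u. Poly_Mapping.lookup u x)"

definition L0 :: "('x \<Rightarrow>\<^sub>0 'f::field) set" where
  "L0 = {u. coeff_sum u = 0}"

text \<open>The points of a normal form of \<open>u\<close> are exactly the generators at the keys of \<open>u\<close>.\<close>

definition supp :: "('x \<Rightarrow>\<^sub>0 'f::field) \<Rightarrow> ('x \<Rightarrow>\<^sub>0 'f) set" where
  "supp u =
     (if u = 0 then {0}
      else if u \<in> L0 then gen ` Poly_Mapping.keys u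
      else insert 0 (gen ` Poly_Mapping.keys u))"

text \<open>For \<open>n = 0\<close> this is the empty sum, the degenerate normal form of \<open>0\<close>.\<close>

definition normal_form ::
  "('x \<Rightarrow>\<^sub>0 'f::field) \<Rightarrow> nat \<Rightarrow> (nat \<Rightarrow> 'f) \<Rightarrow> (nat \<Rightarrow> ('x \<Rightarrow>\<^sub>0 'f)) \<Rightarrow> bool" where
  "normal_form u n l x \<longleftrightarrow>
     (\<forall>i\<in>{1..n}. x i \<in> range gen) \<and> inj_on x {1..n} \<and> (\<forall>i\<in>{1..n}. l i \<noteq> 0) \<and>
     u = (\<Sum>i=1..n. scale (l i) (x i))"

definition nonarch_valuation :: "('f::field \<Rightarrow> real) \<Rightarrow> bool" where
  "nonarch_valuation v \<longleftrightarrow>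
     (\<forall>a. 0 \<le> v a) \<and> (\<forall>a. v a = 0 \<longleftrightarrow> a = 0) \<and>
     (\<forall>a b. v (a * b) = v a * v b) \<and> (\<forall>a b. v (a + b) \<le> max (v a) (v b))"

definition ultra_pseudometric_on :: "'a set \<Rightarrow> ('a \<Rightarrow> 'a \<Rightarrow> real) \<Rightarrow> bool" where
  "ultra_pseudometric_on S d \<longleftrightarrow>
     (\<forall>x\<in>S. \<forall>y\<in>S. 0 \<le> d x y) \<and> (\<forall>x\<in>S. d x x = 0) \<and>
     (\<forall>x\<in>S. \<forall>y\<in>S. d x y = d y x) \<and>
     (\<forall>x\<in>S. \<forall>y\<in>S. \<forall>z\<in>S. d x z \<le> max (d x y) (d y z))"

definition ultra_metric_on :: "'a set \<Rightarrow> ('a \<Rightarrow> 'a \<Rightarrow> real) \<Rightarrow> bool" where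
  "ultra_metric_on S d \<longleftrightarrow>
     ultra_pseudometric_on S d \<and> (\<forall>x\<in>S. \<forall>y\<in>S. d x y = 0 \<longrightarrow> x = y)"

definition ultra_seminorm ::
  "('f::field \<Rightarrow> real) \<Rightarrow> (('x \<Rightarrow>\<^sub>0 'f) \<Rightarrow> real) \<Rightarrow> bool" where
  "ultra_seminorm v p \<longleftrightarrow>
     (\<forall>u. 0 \<le> p u) \<and> p 0 = 0 \<and> (\<forall>u w. p (u + w) \<le> max (p u) (p w)) \<and>
     (\<forall>a u. p (scale a u) = v a * p u)"

definition ultra_norm ::
  "('f::field \<Rightarrow> real) \<Rightarrow> (('x \<Rightarrow>\<^sub>0 'f) \<Rightarrow> real) \<Rightarrow> bool" where
  "ultra_norm v p \<longleftrightarrow> ultra_seminorm v p \<and> (\<forall>u. p u = 0 \<longrightarrow> u = 0)"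

definition compatible ::
  "(('x \<Rightarrow>\<^sub>0 'f) \<Rightarrow> ('x \<Rightarrow>\<^sub>0 'f) \<Rightarrow> real) \<Rightarrow> (('x \<Rightarrow>\<^sub>0 'f::field) \<Rightarrow> real) \<Rightarrow> bool" where
  "compatible d p \<longleftrightarrow> (\<forall>x\<in>Xbar. \<forall>y\<in>Xbar. p (x - y) = d x y)"

definition Kantorovich_ultra_seminorm ::
  "('f::field \<Rightarrow> real) \<Rightarrow> (('x \<Rightarrow>\<^sub>0 'f) \<Rightarrow> ('x \<Rightarrow>\<^sub>0 'f) \<Rightarrow> real) \<Rightarrow>
   (('x \<Rightarrow>\<^sub>0 'f) \<Rightarrow> real) \<Rightarrow> bool" where
  "Kantorovich_ultra_seminorm v d p \<longleftrightarrow>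
     ultra_seminorm v p \<and> compatible d p \<and>
     (\<forall>q. ultra_seminorm v q \<and> compatible d q \<longrightarrow> (\<forall>u. q u \<le> p u))"

lemma lookup_scale: "Poly_Mapping.lookup (scale a u) x = a * Poly_Mapping.lookup u x"
  by (simp add: scale_def Poly_Mapping.map.rep_eq when_def)

lemma vector_space_scale: "vector_space (scale :: 'f::field \<Rightarrow> ('x \<Rightarrow>\<^sub>0 'f) \<Rightarrow> ('x \<Rightarrow>\<^sub>0 'f))"
  by unfold_locales
    (rule poly_mapping_eqI, simp add: lookup_scale lookup_add algebra_simps)+

end

theory Submission
  imports Defs
begin

text \<open>A representation of \<open>u\<close> as a combination of differences of points of a finite set
  is a matrix over that set. If a point \<open>z\<close> of the set has coefficient zero in \<open>u\<close>, it can be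
  eliminated at no cost: the terms \<open>w\<^sub>b (z - b)\<close> satisfy \<open>\<Sum>w\<^sub>b = 0\<close>, so \<open>z\<close> may be replaced by
  the point \<open>b\<^sub>0\<close> nearest to \<open>z\<close>, and \<open>d b\<^sub>0 b \<le> max (d b\<^sub>0 z) (d z b) = d z b\<close>. Hence the infimum
  over all representations is already reached over those on the support of \<open>u\<close>, where
  compatibility and the separation property can be read off from the coefficients of \<open>u\<close>.\<close>

section \<open>Vector space structure and comparison of infima\<close>

interpretation free: vector_space scale
  by (rule vector_space_scale)

text \<open>Used to compare the set of all admissible bounds with the smaller sets of maxima in the
  two formulas; each direction is one half of mutual cofinality.\<close>

lemma cInf_eq_cofinal:
  fixes A B :: "real set"
  assumes "A \<noteq> {}" "bdd_below A" "bdd_below B"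
    and "\<And>a. a \<in> A \<Longrightarrow> \<exists>b\<in>B. b \<le> a" "\<And>b. b \<in> B \<Longrightarrow> \<exists>a\<in>A. a \<le> b"
  shows "Inf A = Inf B"
proof (rule antisym)
  have "B \<noteq> {}" using assms(1,4) by blast
  then show "Inf A \<le> Inf B" using assms(2,5) by (intro cInf_mono) auto
  show "Inf B \<le> Inf A" using assms(1,3,4) by (intro cInf_mono) auto
qed

section \<open>Generators, coefficient sums and coefficients at points of
  \<open>Xbar\<close>\<close>

lemma gen_eq_iff [simp]: "gen x = gen y \<longleftrightarrow> x = y"
  by (metis gen_def lookup_single_eq lookup_single_not_eq zero_neq_one)

lemma gen_nonzero [simp]: "gen x \<noteq> 0"
  by (metis gen_def lookup_single_eq lookup_zero zero_neq_one)

lemma gen_in_Xbar [simp]: "gen x \<in> Xbar" and zero_in_Xbar [simp]: "0 \<in> Xbar"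
  by (auto simp: Xbar_def)

lemma coeff_sum_superset:
  assumes "finite A" "Poly_Mapping.keys u \<subseteq> A"
  shows "coeff_sum u = (\<Sum>x\<in>A. Poly_Mapping.lookup u x)"
  unfolding coeff_sum_def using assms
  by (intro sum.mono_neutral_left) (auto simp: in_keys_iff)

lemma coeff_sum_add: "coeff_sum (u + w) = coeff_sum u + coeff_sum w"
proof -
  let ?A = "Poly_Mapping.keys u \<union> Poly_Mapping.keys w"
  have "Poly_Mapping.keys (u + w) \<subseteq> ?A" by (rule Poly_Mapping.keys_add)
  then show ?thesis
    using coeff_sum_superset[of ?A u] coeff_sum_superset[of ?A w] coeff_sum_superset[of ?A "u + w"]
    by (simp add: lookup_add sum.distrib)
qed

lemma coeff_sum_scale: "coeff_sum (scale a u) = a * coeff_sum u"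
proof -
  have "Poly_Mapping.keys (scale a u) \<subseteq> Poly_Mapping.keys u"
    by (auto simp: in_keys_iff lookup_scale)
  then show ?thesis
    using coeff_sum_superset[of "Poly_Mapping.keys u" "scale a u"]
    by (simp add: coeff_sum_def lookup_scale sum_distrib_left)
qed

lemma coeff_sum_gen [simp]: "coeff_sum (gen x) = 1"
  by (simp add: coeff_sum_def gen_def)

lemma coeff_sum_zero [simp]: "coeff_sum 0 = 0"
  by (simp add: coeff_sum_def)

text \<open>The zero vector gets the coefficient that makes all coefficients add up to zero, so that
  \<open>coef z (a - b)\<close> treats it like any other point of \<open>Xbar\<close>.\<close>

definition coef :: "('x \<Rightarrow>\<^sub>0 'f::field) \<Rightarrow> ('x \<Rightarrow>\<^sub>0 'f) \<Rightarrow> 'f" where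
  "coef z u = (if z = 0 then - coeff_sum u else Poly_Mapping.lookup u (inv gen z))"

lemma inv_gen [simp]: "inv gen (gen x) = x"
  by (rule inv_f_f) (simp add: inj_def)

lemma coef_gen [simp]: "coef (gen x) u = Poly_Mapping.lookup u x"
  by (simp add: coef_def)

lemma coef_add: "coef z (u + w) = coef z u + coef z w"
  by (simp add: coef_def coeff_sum_add lookup_add)

lemma coef_scale: "coef z (scale a u) = a * coef z u"
  by (simp add: coef_def coeff_sum_scale lookup_scale)

lemma coef_zero [simp]: "coef z 0 = 0"
  by (simp add: coef_def)

lemma coef_diff: "coef z (u - w) = coef z u - coef z w"
  by (metis add_diff_cancel_right' coef_add diff_add_cancel)

lemma coef_sum: "coef z (sum f A) = (\<Sum>a\<in>A. coef z (f a))"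
  by (induction A rule: infinite_finite_induct) (auto simp: coef_add)

text \<open>A generator has coefficient sum 1, hence value -1 at the zero vector. The correction
  \<open>of_bool (z = 0)\<close> does not depend on \<open>a\<close>, so it cancels in differences
  of points.\<close>

lemma coef_point:
  assumes "a \<in> Xbar" "z \<in> Xbar"
  shows "coef z a = of_bool (a = z) - of_bool (z = 0)"
  using assms by (auto simp: Xbar_def coef_def coeff_sum_add gen_def[symmetric])
    (auto simp: gen_def lookup_single when_def)

lemma coef_point_diff:
  assumes "a \<in> Xbar" "b \<in> Xbar" "z \<in> Xbar"
  shows "coef z (a - b) = of_bool (a = z) - of_bool (b = z)"
  using assms by (simp add: coef_diff coef_point)

text \<open>With \<open>c\<close> read as a flow between points, this is the net outflow at
  \<open>z\<close>. Every later lower estimate extracts information about \<open>c\<close> from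
  \<open>u\<close> through this identity; the diagonal of \<open>c\<close> cancels in it.\<close>

lemma coef_combination:
  assumes "finite S" "S \<subseteq> Xbar" "z \<in> S"
  shows "coef z (\<Sum>a\<in>S. \<Sum>b\<in>S. scale (c a b) (a - b)) = (\<Sum>b\<in>S. c z b) - (\<Sum>b\<in>S. c b z)"
proof -
  have "coef z (\<Sum>a\<in>S. \<Sum>b\<in>S. scale (c a b) (a - b)) =
      (\<Sum>a\<in>S. \<Sum>b\<in>S. c a b * (of_bool (a = z) - of_bool (b = z)))"
    unfolding coef_sum coef_scale using assms
    by (intro sum.cong refl) (auto simp: coef_point_diff subset_iff)
  also have "\<dots> = (\<Sum>a\<in>S. \<Sum>b\<in>S. c a b * of_bool (a = z)) - (\<Sum>a\<in>S. \<Sum>b\<in>S. c a b * of_bool (b = z))"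
    by (simp add: right_diff_distrib sum_subtractf)
  also have "(\<Sum>a\<in>S. \<Sum>b\<in>S. c a b * of_bool (a = z)) = (\<Sum>b\<in>S. c z b)"
    using assms by (subst sum.swap) (simp add: of_bool_def if_distrib[of "(*) _"] cong: if_cong)
  also have "(\<Sum>a\<in>S. \<Sum>b\<in>S. c a b * of_bool (b = z)) = (\<Sum>b\<in>S. c b z)"
    using assms by (simp add: of_bool_def if_distrib[of "(*) _"] cong: if_cong)
  finally show ?thesis .
qed

section \<open>Supports and normal forms\<close>

lemma finite_supp [simp]: "finite (supp u)"
  by (simp add: supp_def)

lemma supp_subset: "supp u \<subseteq> Xbar"
  by (auto simp: supp_def)

lemma supp_nonempty [simp]: "supp u \<noteq> {}"
  by (auto simp: supp_def)

text \<open>For nonzero \<open>u\<close> the zero vector joins the support exactly when the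
  coefficient sum, that is, up to sign, the coefficient at zero, does not vanish.\<close>

lemma coef_not_in_supp:
  assumes "z \<in> Xbar" "z \<notin> supp u"
  shows "coef z u = 0"
  using assms by (auto simp: supp_def Xbar_def coef_def L0_def in_keys_iff split: if_splits)

lemma key_decomposition: "u = (\<Sum>x\<in>Poly_Mapping.keys u. scale (Poly_Mapping.lookup u x) (gen x))"
proof (rule poly_mapping_eqI)
  fix y
  show "Poly_Mapping.lookup u y =
      Poly_Mapping.lookup (\<Sum>x\<in>Poly_Mapping.keys u. scale (Poly_Mapping.lookup u x) (gen x)) y"
    by (auto simp: lookup_sum lookup_scale gen_def lookup_single when_def in_keys_iff
        if_distrib[of "(*) _"] cong: if_cong)
qed

text \<open>Uniqueness of normal forms up to order: distinctness of the \<open>x i\<close> prevents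
  terms from merging, and nonzero \<open>l i\<close> make each of them a key.\<close>

lemma normal_form_keys:
  assumes "normal_form u n l x"
  shows "gen ` Poly_Mapping.keys u = x ` {1..n}"
    and "\<And>i. i \<in> {1..n} \<Longrightarrow> coef (x i) u = l i"
proof -
  have u: "u = (\<Sum>i=1..n. scale (l i) (x i))" and inj: "inj_on x {1..n}"
    and l: "\<And>i. i \<in> {1..n} \<Longrightarrow> l i \<noteq> 0"
    using assms by (simp_all add: normal_form_def)
  have "\<forall>i\<in>{1..n}. \<exists>g. x i = gen g" using assms by (auto simp: normal_form_def)
  then obtain g where g: "\<And>i. i \<in> {1..n} \<Longrightarrow> x i = gen (g i)" by metis
  have lu: "Poly_Mapping.lookup u y = (\<Sum>i=1..n. l i * of_bool (g i = y))" for y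
    unfolding u lookup_sum lookup_scale
    by (intro sum.cong refl) (auto simp: g gen_def lookup_single when_def)
  have eq: "g j = g i \<longleftrightarrow> j = i" if "i \<in> {1..n}" "j \<in> {1..n}" for i j
    using that inj g[OF that(1)] g[OF that(2)] by (metis inj_onD)
  have lg: "Poly_Mapping.lookup u (g i) = l i" if i: "i \<in> {1..n}" for i
  proof -
    have "Poly_Mapping.lookup u (g i) = (\<Sum>j=1..n. if j = i then l j else 0)"
      unfolding lu using eq[OF i] by (intro sum.cong) auto
    then show ?thesis using i by simp
  qed
  show "coef (x i) u = l i" if "i \<in> {1..n}" for i
    using that by (simp add: g lg)
  have "Poly_Mapping.keys u = g ` {1..n}"
  proof
    show "Poly_Mapping.keys u \<subseteq> g ` {1..n}"
    proof
      fix y assume "y \<in> Poly_Mapping.keys u"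
      then have "(\<Sum>i=1..n. l i * of_bool (g i = y)) \<noteq> 0" by (simp add: in_keys_iff lu)
      then obtain i where "i \<in> {1..n}" "l i * of_bool (g i = y) \<noteq> 0"
        by (meson sum.not_neutral_contains_not_neutral)
      then show "y \<in> g ` {1..n}" by (auto split: if_splits)
    qed
    show "g ` {1..n} \<subseteq> Poly_Mapping.keys u"
      using lg l by (auto simp: in_keys_iff)
  qed
  then show "gen ` Poly_Mapping.keys u = x ` {1..n}"
    using g by (auto simp: image_image)
qed

text \<open>The first \<open>n\<close> points already exhaust the generators in the support, and
  injectivity forbids repeating them, so only the zero vector is left for an index beyond
  \<open>n\<close>.\<close>

lemma normal_form_tail:
  assumes "normal_form u n l x" "m = card (supp u)" "supp u = x ` {1..m}"
  shows "inj_on x {1..m}" "n \<le> m" "\<And>i. i \<in> {1..m} \<Longrightarrow> n < i \<Longrightarrow> x i = 0"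
proof -
  show inj: "inj_on x {1..m}"
    using assms(2,3) by (intro eq_card_imp_inj_on) auto
  have keys: "gen ` Poly_Mapping.keys u = x ` {1..n}" by (rule normal_form_keys(1)[OF assms(1)])
  have "n = card (x ` {1..n})"
    using assms(1) by (simp add: normal_form_def card_image)
  also have "\<dots> \<le> card (supp u)"
    unfolding keys[symmetric] by (intro card_mono) (auto simp: supp_def)
  finally show nm: "n \<le> m" using assms(2) by simp
  show "x i = 0" if i: "i \<in> {1..m}" "n < i" for i
  proof (rule ccontr)
    assume "x i \<noteq> 0"
    moreover have "x i \<in> supp u" using i assms(3) by auto
    ultimately have "x i \<in> x ` {1..n}" using keys by (auto simp: supp_def split: if_splits)
    then obtain j where "j \<in> {1..n}" "x i = x j" by auto
    then show False using inj i nm by (auto dest!: inj_onD)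
  qed
qed

section \<open>Estimates for the valuation and the distance\<close>

locale ultra_distance =
  fixes v :: "'f::field \<Rightarrow> real"
    and d :: "('x \<Rightarrow>\<^sub>0 'f) \<Rightarrow> ('x \<Rightarrow>\<^sub>0 'f) \<Rightarrow> real"
  assumes val: "nonarch_valuation v"
    and dist: "ultra_pseudometric_on Xbar d"
begin

lemma v_nonneg [simp]: "0 \<le> v a"
  and v_eq_0 [simp]: "v a = 0 \<longleftrightarrow> a = 0"
  and v_mult: "v (a * b) = v a * v b"
  and v_add: "v (a + b) \<le> max (v a) (v b)"
  using val by (auto simp: nonarch_valuation_def)

lemma v_0 [simp]: "v 0 = 0"
  by simp

lemma v_1 [simp]: "v 1 = 1"
  using v_mult[of 1 1] by simp

text \<open>The valuation of \<open>-1\<close> is a nonnegative square root of 1.\<close>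

lemma v_minus [simp]: "v (- a) = v a"
proof -
  have "v (-1) * v (-1) = 1" using v_mult[of "-1" "-1"] by simp
  then have "v (-1) = 1"
    using v_nonneg[of "-1"] by (metis abs_of_nonneg abs_square_eq_1 power2_eq_square)
  then show ?thesis using v_mult[of "-1" a] by simp
qed

lemma v_diff: "v (a - b) \<le> max (v a) (v b)"
  using v_add[of a "- b"] by simp

lemma v_sum_le:
  assumes "0 \<le> r" "\<And>i. i \<in> A \<Longrightarrow> v (f i) \<le> r"
  shows "v (sum f A) \<le> r"
  using assms(2)
proof (induction A rule: infinite_finite_induct)
  case (insert a A)
  then show ?case using v_add[of "f a" "sum f A"] by fastforce
qed (use assms(1) in auto)

lemma d_nonneg: "a \<in> Xbar \<Longrightarrow> b \<in> Xbar \<Longrightarrow> 0 \<le> d a b"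
  and d_refl: "a \<in> Xbar \<Longrightarrow> d a a = 0"
  and d_sym: "a \<in> Xbar \<Longrightarrow> b \<in> Xbar \<Longrightarrow> d a b = d b a"
  and d_ultra: "a \<in> Xbar \<Longrightarrow> b \<in> Xbar \<Longrightarrow> c \<in> Xbar \<Longrightarrow> d a c \<le> max (d a b) (d b c)"
  using dist unfolding ultra_pseudometric_on_def by blast+

section \<open>Combinations of differences with bounded cost\<close>

text \<open>Indexing the terms by pairs of points loses nothing: terms with the same pair merge
  without raising the bound, by the strong triangle inequality.\<close>

definition ball_on :: "('x \<Rightarrow>\<^sub>0 'f) set \<Rightarrow> real \<Rightarrow> ('x \<Rightarrow>\<^sub>0 'f) set" where
  "ball_on S r = {(\<Sum>a\<in>S. \<Sum>b\<in>S. scale (c a b) (a - b)) | c.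
     \<forall>a\<in>S. \<forall>b\<in>S. v (c a b) * d a b \<le> r}"

lemma ball_onI:
  "u = (\<Sum>a\<in>S. \<Sum>b\<in>S. scale (c a b) (a - b)) \<Longrightarrow>
    (\<And>a b. a \<in> S \<Longrightarrow> b \<in> S \<Longrightarrow> v (c a b) * d a b \<le> r) \<Longrightarrow> u \<in> ball_on S r"
  unfolding ball_on_def by blast

lemma ball_onE:
  assumes "u \<in> ball_on S r"
  obtains c where "u = (\<Sum>a\<in>S. \<Sum>b\<in>S. scale (c a b) (a - b))"
    "\<And>a b. a \<in> S \<Longrightarrow> b \<in> S \<Longrightarrow> v (c a b) * d a b \<le> r"
  using assms unfolding ball_on_def by blast

lemma ball_on_zero: "0 \<le> r \<Longrightarrow> 0 \<in> ball_on S r"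
  by (rule ball_onI[where c = "\<lambda>_ _. 0"]) simp_all

lemma ball_on_mono: "u \<in> ball_on S r \<Longrightarrow> r \<le> r' \<Longrightarrow> u \<in> ball_on S r'"
  unfolding ball_on_def by force

text \<open>Entrywise addition of the matrices keeps the same bound \<open>r\<close>, since the
  valuation of a sum is at most the maximum.\<close>

lemma ball_on_add:
  assumes "S \<subseteq> Xbar" "u \<in> ball_on S r" "w \<in> ball_on S r"
  shows "u + w \<in> ball_on S r"
proof -
  obtain c where c: "u = (\<Sum>a\<in>S. \<Sum>b\<in>S. scale (c a b) (a - b))"
    "\<And>a b. a \<in> S \<Longrightarrow> b \<in> S \<Longrightarrow> v (c a b) * d a b \<le> r" using assms(2) by (rule ball_onE) blast
  obtain c' where c': "w = (\<Sum>a\<in>S. \<Sum>b\<in>S. scale (c' a b) (a - b))"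
    "\<And>a b. a \<in> S \<Longrightarrow> b \<in> S \<Longrightarrow> v (c' a b) * d a b \<le> r" using assms(3) by (rule ball_onE) blast
  show ?thesis
  proof (rule ball_onI[where c = "\<lambda>a b. c a b + c' a b"])
    fix a b assume ab: "a \<in> S" "b \<in> S"
    have "v (c a b + c' a b) * d a b \<le> max (v (c a b)) (v (c' a b)) * d a b"
      using ab assms(1) by (intro mult_right_mono v_add d_nonneg) auto
    also have "\<dots> \<le> r" using c(2)[OF ab] c'(2)[OF ab] by (simp add: max_def)
    finally show "v (c a b + c' a b) * d a b \<le> r" .
  qed (simp add: c c' free.scale_left_distrib sum.distrib)
qed

lemma ball_on_sum:
  assumes "S \<subseteq> Xbar" "0 \<le> r" "\<And>i. i \<in> I \<Longrightarrow> f i \<in> ball_on S r"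
  shows "sum f I \<in> ball_on S r"
  using assms(3)
  by (induction I rule: infinite_finite_induct) (auto simp: ball_on_zero ball_on_add assms(1,2))

lemma ball_on_scale:
  assumes "u \<in> ball_on S r"
  shows "scale s u \<in> ball_on S (v s * r)"
proof -
  obtain c where c: "u = (\<Sum>a\<in>S. \<Sum>b\<in>S. scale (c a b) (a - b))"
    "\<And>a b. a \<in> S \<Longrightarrow> b \<in> S \<Longrightarrow> v (c a b) * d a b \<le> r" using assms by (rule ball_onE) blast
  show ?thesis
    by (rule ball_onI[where c = "\<lambda>a b. s * c a b"])
      (simp_all add: c free.scale_sum_right v_mult mult.assoc mult_left_mono)
qed

lemma ball_on_term:
  assumes "finite S" "S \<subseteq> Xbar" "a \<in> S" "b \<in> S" "0 \<le> r" "v s * d a b \<le> r"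
  shows "scale s (a - b) \<in> ball_on S r"
proof (rule ball_onI[where c = "\<lambda>a' b'. if a' = a then if b' = b then s else 0 else 0"])
  have "(\<Sum>a'\<in>S. \<Sum>b'\<in>S. scale (if a' = a then if b' = b then s else 0 else 0) (a' - b')) =
      (\<Sum>a'\<in>S. if a' = a then (\<Sum>b'\<in>S. if b' = b then scale s (a - b) else 0) else 0)"
    by (intro sum.cong refl) (auto intro!: sum.cong sum.neutral)
  then show "scale s (a - b) =
      (\<Sum>a'\<in>S. \<Sum>b'\<in>S. scale (if a' = a then if b' = b then s else 0 else 0) (a' - b'))"
    using assms by simp
qed (use assms in auto)

lemma ball_on_superset:
  assumes "finite T" "T \<subseteq> Xbar" "S \<subseteq> T" "0 \<le> r" "u \<in> ball_on S r"
  shows "u \<in> ball_on T r"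
proof -
  obtain c where c: "u = (\<Sum>a\<in>S. \<Sum>b\<in>S. scale (c a b) (a - b))"
    "\<And>a b. a \<in> S \<Longrightarrow> b \<in> S \<Longrightarrow> v (c a b) * d a b \<le> r" using assms(5) by (rule ball_onE) blast
  show ?thesis
    unfolding c(1) using assms c(2) by (intro ball_on_sum ball_on_term) auto
qed

lemma ball_on_eliminate:
  assumes fin: "finite S" and sub: "insert z S \<subseteq> Xbar" and z: "z \<notin> S" and "S \<noteq> {}" and r: "0 \<le> r"
    and u: "u \<in> ball_on (insert z S) r" and coef: "coef z u = 0"
  shows "u \<in> ball_on S r"
proof -
  let ?T = "insert z S"
  obtain c where c: "u = (\<Sum>a\<in>?T. \<Sum>b\<in>?T. scale (c a b) (a - b))"
    "\<And>a b. a \<in> ?T \<Longrightarrow> b \<in> ?T \<Longrightarrow> v (c a b) * d a b \<le> r" using u by (rule ball_onE) blast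
  \<comment> \<open>The terms of both orientations merge because
    \<open>b - z = - (z - b)\<close>.\<close>
  define w where "w b = c z b - c b z" for b
  have "coef z u = (\<Sum>b\<in>?T. c z b) - (\<Sum>b\<in>?T. c b z)"
    unfolding c(1) using fin sub by (intro coef_combination) auto
  then have w0: "(\<Sum>b\<in>S. w b) = 0"
    using coef fin z by (simp add: w_def sum_subtractf)
  obtain b0 where b0: "b0 \<in> S" "\<And>b. b \<in> S \<Longrightarrow> d z b0 \<le> d z b"
    using fin \<open>S \<noteq> {}\<close> by (metis arg_min_if_finite(1) arg_min_least)
  have w_term: "scale (c z b) (z - b) + scale (c b z) (b - z) = scale (w b) (z - b)" for b
    by (simp add: w_def free.scale_left_diff_distrib free.scale_right_diff_distrib)
  \<comment> \<open>After summation over \<open>b\<close> the second summands give the multiple of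
    \<open>z - b0\<close> by the sum of all \<open>w b\<close>, which is zero.\<close>
  have w_split: "scale (w b) (z - b) = scale (w b) (b0 - b) + scale (w b) (z - b0)" for b
    by (simp add: free.scale_right_diff_distrib)
  have "u = (\<Sum>b\<in>S. scale (c z b) (z - b)) +
      ((\<Sum>a\<in>S. scale (c a z) (a - z)) + (\<Sum>a\<in>S. \<Sum>b\<in>S. scale (c a b) (a - b)))"
    unfolding c(1) using fin z by (simp add: sum.distrib)
  also have "\<dots> = (\<Sum>a\<in>S. \<Sum>b\<in>S. scale (c a b) (a - b)) + (\<Sum>b\<in>S. scale (w b) (z - b))"
    by (simp add: w_term[symmetric] sum.distrib)
  also have "(\<Sum>b\<in>S. scale (w b) (z - b)) = (\<Sum>b\<in>S. scale (w b) (b0 - b))"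
    by (simp add: w_split sum.distrib free.scale_sum_left[symmetric] w0)
  finally have u_eq: "u = (\<Sum>a\<in>S. \<Sum>b\<in>S. scale (c a b) (a - b)) + (\<Sum>b\<in>S. scale (w b) (b0 - b))" .
  have w_bound: "v (w b) * d b0 b \<le> r" if b: "b \<in> S" for b
  proof -
    have mem: "z \<in> Xbar" "b \<in> Xbar" "b0 \<in> Xbar" using b b0 sub by auto
    have "d b0 b \<le> d z b"
      using d_ultra[OF mem(3,1,2)] b0(2)[OF b] d_sym[OF mem(3,1)] by simp
    then have "v (w b) * d b0 b \<le> max (v (c z b)) (v (c b z)) * d z b"
      unfolding w_def using mem by (intro mult_mono v_diff d_nonneg) (auto simp: le_max_iff_disj)
    also have "\<dots> \<le> r"
      using c(2)[of z b] c(2)[of b z] b d_sym[OF mem(1,2)] by (auto simp: max_def)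
    finally show ?thesis .
  qed
  show ?thesis
    unfolding u_eq using fin sub b0 w_bound c(2) r
    by (intro ball_on_add ball_on_sum ball_on_term) auto
qed

text \<open>Points of \<open>D\<close> outside \<open>T\<close> are eliminated one at a time; since
  \<open>T\<close> is nonempty, a replacement point always remains.\<close>

lemma ball_on_restrict:
  assumes "finite D" "finite T" "D \<union> T \<subseteq> Xbar" "T \<noteq> {}" "0 \<le> r"
    and "u \<in> ball_on (D \<union> T) r" "\<And>z. z \<in> D - T \<Longrightarrow> coef z u = 0"
  shows "u \<in> ball_on T r"
  using assms(1,3,6,7)
proof (induction D rule: finite_induct)
  case (insert z D)
  have "u \<in> ball_on (D \<union> T) r"
  proof (cases "z \<in> T")
    case True
    then show ?thesis using insert.prems(2) by (simp add: insert_absorb)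
  next
    case False
    show ?thesis
    proof (rule ball_on_eliminate[where z = z])
      show "u \<in> ball_on (insert z (D \<union> T)) r" using insert.prems(2) by simp
      show "coef z u = 0" using insert.prems(3) False by simp
    qed (use insert.prems(1) insert.hyps False assms(2,4,5) in auto)
  qed
  then show ?case
    using insert.prems(1,3) by (intro insert.IH) simp_all
qed simp

lemma ball_on_supp:
  assumes "finite S" "S \<subseteq> Xbar" "0 \<le> r" "u \<in> ball_on S r"
  shows "u \<in> ball_on (supp u) r"
proof (rule ball_on_restrict)
  show "u \<in> ball_on (S \<union> supp u) r"
    using assms supp_subset by (intro ball_on_superset[of "S \<union> supp u" S]) auto
qed (use assms supp_subset in \<open>auto intro: coef_not_in_supp\<close>)

text \<open>Each \<open>gen x\<close> is written as \<open>gen x - 0\<close>. The auxiliary point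
  \<open>0\<close> may lie outside the support and is then eliminated again by
  \<open>ball_on_supp\<close>.\<close>

lemma ball_on_supp_nonempty: "\<exists>r\<ge>0. u \<in> ball_on (supp u) r"
proof -
  let ?K = "Poly_Mapping.keys u"
  let ?t = "\<lambda>x. v (Poly_Mapping.lookup u x) * d (gen x) 0"
  \<comment> \<open>The bound only has to dominate each single cost; the sum of the costs does so
    and also makes sense when there are no keys.\<close>
  have "(\<Sum>x\<in>?K. scale (Poly_Mapping.lookup u x) (gen x - 0)) \<in>
      ball_on (insert 0 (gen ` ?K)) (\<Sum>x\<in>?K. ?t x)"
    by (intro ball_on_sum ball_on_term)
      (auto intro!: sum_nonneg mult_nonneg_nonneg d_nonneg member_le_sum)
  then have "u \<in> ball_on (insert 0 (gen ` ?K)) (\<Sum>x\<in>?K. ?t x)"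
    using key_decomposition[of u] by simp
  then show ?thesis
    by (intro exI[of _ "\<Sum>x\<in>?K. ?t x"])
      (auto intro!: ball_on_supp[of "insert 0 (gen ` ?K)"] sum_nonneg mult_nonneg_nonneg d_nonneg)
qed

section \<open>The extremal seminorm as an infimum\<close>

definition radii :: "('x \<Rightarrow>\<^sub>0 'f) \<Rightarrow> real set" where
  "radii u = {r. 0 \<le> r \<and> u \<in> ball_on (supp u) r}"

text \<open>The infimal cost of \<open>u\<close> over its own support; by
  \<open>ball_on_supp\<close> no other finite set of points gives a smaller value.\<close>

definition K_norm :: "('x \<Rightarrow>\<^sub>0 'f) \<Rightarrow> real" where
  "K_norm u = Inf (radii u)"

lemma radii_nonempty: "radii u \<noteq> {}"
  using ball_on_supp_nonempty by (auto simp: radii_def)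

lemma radii_bdd: "bdd_below (radii u)"
  by (auto simp: radii_def intro: bdd_belowI[of _ 0])

text \<open>Upper estimates may use any finite set of points, whereas lower estimates through
  \<open>K_norm_ge\<close> need only treat the support.\<close>

lemma K_norm_le:
  "finite S \<Longrightarrow> S \<subseteq> Xbar \<Longrightarrow> 0 \<le> r \<Longrightarrow> u \<in> ball_on S r \<Longrightarrow> K_norm u \<le> r"
  unfolding K_norm_def by (intro cInf_lower radii_bdd) (auto simp: radii_def intro: ball_on_supp)

lemma K_norm_ge:
  "(\<And>r. 0 \<le> r \<Longrightarrow> u \<in> ball_on (supp u) r \<Longrightarrow> t \<le> r) \<Longrightarrow> t \<le> K_norm u"
  unfolding K_norm_def by (intro cInf_greatest radii_nonempty) (auto simp: radii_def)

lemma K_norm_nonneg: "0 \<le> K_norm u"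
  by (rule K_norm_ge)

lemma K_norm_approx:
  assumes "0 < e"
  obtains r where "0 \<le> r" "u \<in> ball_on (supp u) r" "r < K_norm u + e"
  using cInf_lessD[OF radii_nonempty[of u], of "K_norm u + e"] assms
  by (auto simp: K_norm_def radii_def)

lemma K_norm_0: "K_norm 0 = 0"
  using K_norm_nonneg[of 0] K_norm_le[of "{}" 0 0] ball_on_zero[of 0] by simp

lemma K_norm_add: "K_norm (u + w) \<le> max (K_norm u) (K_norm w)"
proof (rule field_le_epsilon)
  fix e :: real assume e: "0 < e"
  obtain r where r: "0 \<le> r" "u \<in> ball_on (supp u) r" "r < K_norm u + e"
    using e by (rule K_norm_approx)
  obtain r' where r': "0 \<le> r'" "w \<in> ball_on (supp w) r'" "r' < K_norm w + e"
    using e by (rule K_norm_approx)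
  \<comment> \<open>Both representations are moved to the union of the supports, which may be larger
    than the support of \<open>u + w\<close>.\<close>
  have sub: "finite (supp u \<union> supp w)" "supp u \<union> supp w \<subseteq> Xbar" using supp_subset by auto
  have "u \<in> ball_on (supp u \<union> supp w) (max r r')"
    using ball_on_superset[OF sub _ r(1,2)] ball_on_mono by fastforce
  moreover have "w \<in> ball_on (supp u \<union> supp w) (max r r')"
    using ball_on_superset[OF sub _ r'(1,2)] ball_on_mono by fastforce
  ultimately have "K_norm (u + w) \<le> max r r'"
    using sub r(1) by (intro K_norm_le[OF sub] ball_on_add) auto
  then show "K_norm (u + w) \<le> max (K_norm u) (K_norm w) + e" using r(3) r'(3) by linarith
qed

lemma K_norm_scale_le: "K_norm (scale a u) \<le> v a * K_norm u"
proof (cases "a = 0")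
  case False
  then have pos: "0 < v a" using v_nonneg[of a] v_eq_0[of a] by linarith
  have "K_norm (scale a u) / v a \<le> K_norm u"
  proof (rule K_norm_ge)
    fix r assume "0 \<le> r" "u \<in> ball_on (supp u) r"
    then have "K_norm (scale a u) \<le> v a * r"
      using supp_subset by (intro K_norm_le[of "supp u"] ball_on_scale) auto
    then show "K_norm (scale a u) / v a \<le> r" using pos by (simp add: field_simps)
  qed
  then show ?thesis using pos by (simp add: field_simps)
qed (simp add: K_norm_0)

text \<open>For \<open>a \<noteq> 0\<close> the reverse inequality is \<open>K_norm_scale_le\<close>
  for \<open>inverse a\<close>, multiplied by \<open>v a\<close>.\<close>

lemma K_norm_scale: "K_norm (scale a u) = v a * K_norm u"
proof (cases "a = 0")
  case False
  then have pos: "0 < v a" using v_nonneg[of a] v_eq_0[of a] by linarith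
  have "v (inverse a) * v a = 1" using False v_mult[of "inverse a" a] by simp
  moreover have "K_norm u \<le> v (inverse a) * K_norm (scale a u)"
    using K_norm_scale_le[of "inverse a" "scale a u"] False by simp
  then have "v a * K_norm u \<le> v a * (v (inverse a) * K_norm (scale a u))"
    by (intro mult_left_mono) auto
  ultimately have "v a * K_norm u \<le> K_norm (scale a u)"
    by (metis mult.assoc mult.commute mult_1)
  then show ?thesis using K_norm_scale_le[of a u] by linarith
qed (simp add: K_norm_0)

lemma ultra_seminorm_K_norm: "ultra_seminorm v K_norm"
  by (simp add: ultra_seminorm_def K_norm_nonneg K_norm_0 K_norm_add K_norm_scale)

section \<open>Compatibility, maximality and uniqueness\<close>

lemma K_norm_compatible: "compatible d K_norm"
  unfolding compatible_def
proof (intro ballI antisym)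
  fix x y :: "'x \<Rightarrow>\<^sub>0 'f" assume xy: "x \<in> Xbar" "y \<in> Xbar"
  have "scale 1 (x - y) \<in> ball_on {x, y} (d x y)"
    using xy by (intro ball_on_term) (auto intro: d_nonneg)
  then show "K_norm (x - y) \<le> d x y"
    using xy by (intro K_norm_le[of "{x, y}"]) (auto intro: d_nonneg)
  show "d x y \<le> K_norm (x - y)"
  proof (cases "x = y")
    case True
    then show ?thesis using xy by (simp add: d_refl K_norm_0)
  next
    case False
    show ?thesis
    proof (rule K_norm_ge)
      let ?T = "{x, y}"
      fix r assume r: "0 \<le> r" "x - y \<in> ball_on (supp (x - y)) r"
      \<comment> \<open>Instead of computing the support of \<open>x - y\<close>, its representation
        is transferred to \<open>{x, y}\<close>, outside of which all coefficients vanish.\<close>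
      have "x - y \<in> ball_on ?T r"
      proof (rule ball_on_restrict)
        show "x - y \<in> ball_on (supp (x - y) \<union> ?T) r"
          using r xy supp_subset[of "x - y"]
          by (intro ball_on_superset[of "supp (x - y) \<union> ?T" "supp (x - y)"]) auto
        show "coef z (x - y) = 0" if "z \<in> supp (x - y) - ?T" for z
          using that xy supp_subset[of "x - y"] by (auto simp: coef_point_diff subset_iff)
      qed (use r xy supp_subset in auto)
      then obtain c where c: "x - y = (\<Sum>a\<in>?T. \<Sum>b\<in>?T. scale (c a b) (a - b))"
        "\<And>a b. a \<in> ?T \<Longrightarrow> b \<in> ?T \<Longrightarrow> v (c a b) * d a b \<le> r" by (rule ball_onE) blast
      have "coef x (x - y) = (\<Sum>b\<in>?T. c x b) - (\<Sum>b\<in>?T. c b x)"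
        unfolding c(1) using xy by (intro coef_combination) auto
      \<comment> \<open>The coefficient of \<open>x - y\<close> at \<open>x\<close> is 1 and the
        diagonal cancels. Hence one of the two entries has valuation at least 1, and its term alone
        costs at least \<open>d x y\<close>.\<close>
      then have "c x y - c y x = 1"
        using False xy by (simp add: coef_point_diff)
      then have "1 \<le> max (v (c x y)) (v (c y x))"
        using v_diff[of "c x y" "c y x"] by simp
      then have "1 * d x y \<le> max (v (c x y)) (v (c y x)) * d x y"
        using xy by (intro mult_right_mono d_nonneg) auto
      also have "\<dots> \<le> r"
        using c(2)[of x y] c(2)[of y x] d_sym[OF xy] by (auto simp: max_def)
      finally show "d x y \<le> r" by simp
    qed
  qed
qed

lemma seminorm_sum_le:
  assumes "ultra_seminorm v q" "0 \<le> r" "\<And>i. i \<in> I \<Longrightarrow> q (f i) \<le> r"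
  shows "q (sum f I) \<le> r"
  using assms(3)
proof (induction I rule: infinite_finite_induct)
  case (insert a A)
  have "q (f a + sum f A) \<le> max (q (f a)) (q (sum f A))"
    using assms(1) by (simp add: ultra_seminorm_def)
  also have "\<dots> \<le> r" using insert by simp
  finally show ?case using insert.hyps by simp
qed (use assms in \<open>auto simp: ultra_seminorm_def\<close>)

text \<open>Compatibility makes \<open>q\<close> of a term equal to its cost, and the ultrametric
  inequality bounds \<open>q u\<close> by the largest cost in any representation.\<close>

lemma compatible_le_K_norm:
  assumes q: "ultra_seminorm v q" "compatible d q"
  shows "q u \<le> K_norm u"
proof (rule K_norm_ge)
  fix r assume r: "0 \<le> r" "u \<in> ball_on (supp u) r"
  obtain c where c: "u = (\<Sum>a\<in>supp u. \<Sum>b\<in>supp u. scale (c a b) (a - b))"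
    "\<And>a b. a \<in> supp u \<Longrightarrow> b \<in> supp u \<Longrightarrow> v (c a b) * d a b \<le> r" using r(2) by (rule ball_onE) blast
  have "q (scale (c a b) (a - b)) \<le> r" if "a \<in> supp u" "b \<in> supp u" for a b
  proof -
    have "q (a - b) = d a b"
      using q(2) that supp_subset unfolding compatible_def by blast
    then show ?thesis using q(1) c(2)[OF that] by (simp add: ultra_seminorm_def)
  qed
  then have "q (\<Sum>a\<in>supp u. \<Sum>b\<in>supp u. scale (c a b) (a - b)) \<le> r"
    by (intro seminorm_sum_le[OF q(1) r(1)])
  then show "q u \<le> r" using c(1) by simp
qed

lemma Kantorovich_K_norm: "Kantorovich_ultra_seminorm v d K_norm"
  by (simp add: Kantorovich_ultra_seminorm_def ultra_seminorm_K_norm K_norm_compatible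
      compatible_le_K_norm)

text \<open>Two maximal compatible seminorms dominate each other. This carries the results on
  \<open>K_norm\<close> over to an arbitrary Kantorovich ultra-seminorm.\<close>

lemma Kantorovich_unique:
  assumes "Kantorovich_ultra_seminorm v d p"
  shows "p = K_norm"
proof (intro ext antisym)
  fix u
  show "p u \<le> K_norm u"
    using assms compatible_le_K_norm by (auto simp: Kantorovich_ultra_seminorm_def)
  show "K_norm u \<le> p u"
    using assms ultra_seminorm_K_norm K_norm_compatible
    by (auto simp: Kantorovich_ultra_seminorm_def)
qed

section \<open>Separation for an ultra-metric\<close>

text \<open>Distinct points of the finite support are at least some \<open>\<delta> > 0\<close>
  apart, and every representation must produce the nonzero coefficient \<open>?l\<close> of a key.
  So its cost is at least \<open>v ?l * \<delta>\<close>.\<close>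

lemma ultra_norm_K_norm:
  assumes "ultra_metric_on Xbar d"
  shows "ultra_norm v K_norm"
  unfolding ultra_norm_def
proof (intro conjI allI impI ultra_seminorm_K_norm)
  fix u assume u0: "K_norm u = 0"
  show "u = 0"
  proof (rule ccontr)
    assume "u \<noteq> 0"
    then obtain x where x: "x \<in> Poly_Mapping.keys u" by fastforce
    let ?S = "supp u" and ?l = "Poly_Mapping.lookup u x"
    \<comment> \<open>The added 1 guarantees a minimum without exhibiting two distinct points of the
      support.\<close>
    define D where "D = insert 1 ((\<lambda>(a, b). d a b) ` (?S \<times> ?S - Id))"
    have D: "finite D" "D \<noteq> {}" by (auto simp: D_def)
    have dpos: "0 < t" if "t \<in> D" for t
    proof -
      have "0 < d a b" if "a \<in> ?S" "b \<in> ?S" "a \<noteq> b" for a b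
        using that assms supp_subset[of u] d_nonneg[of a b]
        unfolding ultra_metric_on_def by (metis order_le_less subsetD)
      then show ?thesis using that by (auto simp: D_def)
    qed
    define \<delta> where "\<delta> = Min D"
    have \<delta>: "0 < \<delta>" using D dpos by (simp add: \<delta>_def)
    have \<delta>_le: "\<delta> \<le> d a b" if "a \<in> ?S" "b \<in> ?S" "a \<noteq> b" for a b
      unfolding \<delta>_def using that D by (intro Min_le) (auto simp: D_def)
    have xS: "gen x \<in> ?S" using x \<open>u \<noteq> 0\<close> by (simp add: supp_def)
    have "v ?l * \<delta> \<le> K_norm u"
    proof (rule K_norm_ge)
      fix r assume r: "0 \<le> r" "u \<in> ball_on ?S r"
      obtain c where c: "u = (\<Sum>a\<in>?S. \<Sum>b\<in>?S. scale (c a b) (a - b))"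
        "\<And>a b. a \<in> ?S \<Longrightarrow> b \<in> ?S \<Longrightarrow> v (c a b) * d a b \<le> r" using r(2) by (rule ball_onE) blast
      have cv: "v (c a b) \<le> r / \<delta>" if "a \<in> ?S" "b \<in> ?S" "a \<noteq> b" for a b
      proof -
        have "v (c a b) * \<delta> \<le> r"
          using c(2)[OF that(1,2)] mult_left_mono[OF \<delta>_le[OF that], of "v (c a b)"] by simp
        then show ?thesis using \<delta> by (simp add: field_simps)
      qed
      have "?l = coef (gen x) (\<Sum>a\<in>?S. \<Sum>b\<in>?S. scale (c a b) (a - b))" using c(1) by simp
      also have "\<dots> = (\<Sum>b\<in>?S. c (gen x) b) - (\<Sum>b\<in>?S. c b (gen x))"
        using xS supp_subset by (intro coef_combination) auto
      also have "\<dots> = (\<Sum>b\<in>?S. c (gen x) b - c b (gen x))" by (simp add: sum_subtractf)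
      also have "v \<dots> \<le> r / \<delta>"
      proof (rule v_sum_le)
        fix b assume b: "b \<in> ?S"
        show "v (c (gen x) b - c b (gen x)) \<le> r / \<delta>"
        \<comment> \<open>The estimate \<open>cv\<close> holds off the diagonal only; on the
          diagonal the difference is zero.\<close>
        proof (cases "b = gen x")
          case False
          then show ?thesis
            using v_diff[of "c (gen x) b" "c b (gen x)"] cv[OF xS b] cv[OF b xS] by force
        qed (use r \<delta> in simp)
      qed (use r \<delta> in simp)
      finally show "v ?l * \<delta> \<le> r" using \<delta> by (simp add: field_simps)
    qed
    moreover have "0 < v ?l" using x v_nonneg[of ?l] v_eq_0[of ?l] by (simp add: in_keys_iff order_le_less)
    ultimately show False using \<delta> u0 by (simp add: mult_le_0_iff)
  qed
qed

section \<open>The two formulas for the seminorm\<close>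

text \<open>Common frame of both formulas: every maximum in \<open>R\<close> is an admissible
  radius, and every admissible radius is bounded below by such a maximum.\<close>

lemma K_norm_eq_Inf:
  assumes "\<And>r. 0 \<le> r \<Longrightarrow> u \<in> ball_on (supp u) r \<Longrightarrow> \<exists>t\<in>R. t \<le> r"
    and "\<And>t. t \<in> R \<Longrightarrow> 0 \<le> t \<and> u \<in> ball_on (supp u) t"
  shows "K_norm u = Inf R"
  unfolding K_norm_def
proof (rule cInf_eq_cofinal)
  show "bdd_below R" using assms(2) by (auto intro: bdd_belowI[of _ 0])
  show "\<exists>t\<in>R. t \<le> r" if "r \<in> radii u" for r using that assms(1) by (simp add: radii_def)
  show "\<exists>r\<in>radii u. r \<le> t" if "t \<in> R" for t using assms(2)[OF that] by (auto simp: radii_def)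
qed (rule radii_nonempty radii_bdd)+

text \<open>The largest cost in a representation is itself an admissible radius. The general index
  set serves both lists of terms and square matrices.\<close>

lemma max_ball_on_supp:
  assumes "finite I" "I \<noteq> {}" "\<And>i. i \<in> I \<Longrightarrow> x i \<in> supp u \<and> y i \<in> supp u"
    and "u = (\<Sum>i\<in>I. scale (s i) (x i - y i))"
  shows "0 \<le> (MAX i\<in>I. v (s i) * d (x i) (y i))"
    and "u \<in> ball_on (supp u) (MAX i\<in>I. v (s i) * d (x i) (y i))"
proof -
  let ?M = "MAX i\<in>I. v (s i) * d (x i) (y i)"
  have le: "v (s i) * d (x i) (y i) \<le> ?M" if "i \<in> I" for i
    using assms(1) that by (intro Max_ge) auto
  obtain i where "i \<in> I" using assms(2) by blast
  moreover have "0 \<le> v (s i) * d (x i) (y i)"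
    using assms(3)[OF \<open>i \<in> I\<close>] supp_subset[of u] by (intro mult_nonneg_nonneg d_nonneg) auto
  ultimately show M: "0 \<le> ?M" using le[of i] by linarith
  have "(\<Sum>i\<in>I. scale (s i) (x i - y i)) \<in> ball_on (supp u) ?M"
    using assms(3) le M by (intro ball_on_sum ball_on_term supp_subset finite_supp) auto
  then show "u \<in> ball_on (supp u) ?M" using assms(4) by simp
qed

lemma K_norm_on_support:
  "K_norm u =
    Inf {(MAX i\<in>{1..k}. v (s i) * d (x i) (y i)) | (k::nat) s x y.
      1 \<le> k \<and> u = (\<Sum>i=1..k. scale (s i) (x i - y i)) \<and>
      (\<forall>i\<in>{1..k}. x i \<in> supp u \<and> y i \<in> supp u)}" (is "_ = Inf ?R")
proof (rule K_norm_eq_Inf)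
  fix t assume "t \<in> ?R"
  then show "0 \<le> t \<and> u \<in> ball_on (supp u) t"
  proof (elim CollectE exE conjE)
    fix k :: nat and s x y
    assume t: "t = (MAX i\<in>{1..k}. v (s i) * d (x i) (y i))" and k: "1 \<le> k"
      and u: "u = (\<Sum>i=1..k. scale (s i) (x i - y i))"
      and mem: "\<forall>i\<in>{1..k}. x i \<in> supp u \<and> y i \<in> supp u"
    have ne: "{1..k} \<noteq> {}" using k by simp
    show "0 \<le> t \<and> u \<in> ball_on (supp u) t"
      unfolding t by (intro conjI; rule max_ball_on_supp[OF _ ne]) (use mem u in auto)
  qed
next
  fix r assume r: "0 \<le> r" "u \<in> ball_on (supp u) r"
  let ?P = "supp u \<times> supp u"
  obtain c where c: "u = (\<Sum>a\<in>supp u. \<Sum>b\<in>supp u. scale (c a b) (a - b))"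
    "\<And>a b. a \<in> supp u \<Longrightarrow> b \<in> supp u \<Longrightarrow> v (c a b) * d a b \<le> r" using r(2) by (rule ball_onE) blast
  \<comment> \<open>Enumerating all pairs of support points turns the matrix into a list of
    terms.\<close>
  obtain h N where h: "bij_betw h {1..N} ?P" and N: "N = card ?P"
    using ex_bij_betw_nat_finite_1[OF finite_cartesian_product[OF finite_supp finite_supp]] by blast
  \<comment> \<open>The support is never empty, being \<open>{0}\<close> for \<open>u = 0\<close>,
    so the maximum is over a nonempty set.\<close>
  have k: "1 \<le> N" unfolding N by (simp add: Suc_le_eq card_gt_0_iff)
  define s x y where "s i = c (fst (h i)) (snd (h i))" and "x i = fst (h i)" and "y i = snd (h i)" for i
  note defs = this
  have hP: "x i \<in> supp u \<and> y i \<in> supp u" if "i \<in> {1..N}" for i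
    using bij_betwE[OF h] that by (auto simp: defs mem_Times_iff)
  have "u = (\<Sum>p\<in>?P. scale (c (fst p) (snd p)) (fst p - snd p))"
    using c(1) by (simp add: sum.cartesian_product case_prod_unfold)
  also have "\<dots> = (\<Sum>i=1..N. scale (s i) (x i - y i))"
    unfolding defs by (rule sum.reindex_bij_betw[OF h, symmetric])
  finally have u: "u = (\<Sum>i=1..N. scale (s i) (x i - y i))" .
  have "(MAX i\<in>{1..N}. v (s i) * d (x i) (y i)) \<in> ?R"
    by (intro CollectI exI[of _ N] exI[of _ s] exI[of _ x] exI[of _ y] conjI ballI refl k u)
      (use hP in blast)+
  moreover have "v (s i) * d (x i) (y i) \<le> r" if "i \<in> {1..N}" for i
    using c(2)[of "x i" "y i"] hP[OF that] by (simp add: defs)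
  then have "(MAX i\<in>{1..N}. v (s i) * d (x i) (y i)) \<le> r"
    using k by (subst Max_le_iff) auto
  ultimately show "\<exists>t\<in>?R. t \<le> r" by blast
qed

text \<open>The side conditions are flow balances at the generators. An index beyond
  \<open>n\<close> carries the zero vector, so its balance may be arbitrary.\<close>

lemma K_norm_transport:
  assumes nf: "normal_form u n l x" and m: "m = card (supp u)" and sx: "supp u = x ` {1..m}"
  shows "K_norm u =
    Inf {(MAX (i, j)\<in>{1..m} \<times> {1..m}. v (c i j) * d (x i) (x j)) | c.
      (\<forall>i\<in>{1..m}. c i i = 0) \<and>
      (\<forall>i\<in>{1..n}. (\<Sum>j=1..m. c i j) - (\<Sum>j=1..m. c j i) = l i)}" (is "_ = Inf ?R")
proof (rule K_norm_eq_Inf)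
  note inj = normal_form_tail(1)[OF assms] and nm = normal_form_tail(2)[OF assms]
    and tail = normal_form_tail(3)[OF assms]
  have m1: "1 \<le> m" using m by (simp add: Suc_le_eq card_gt_0_iff)
  {
    fix t assume "t \<in> ?R"
    then obtain c where cl: "\<And>i. i \<in> {1..n} \<Longrightarrow> (\<Sum>j=1..m. c i j) - (\<Sum>j=1..m. c j i) = l i"
      and t: "t = (MAX (i, j)\<in>{1..m} \<times> {1..m}. v (c i j) * d (x i) (x j))" by blast
    \<comment> \<open>Sorting the terms by point gives \<open>x i\<close> the coefficient row sum
      minus column sum.\<close>
    have "(\<Sum>(i, j)\<in>{1..m} \<times> {1..m}. scale (c i j) (x i - x j)) =
        (\<Sum>i=1..m. \<Sum>j=1..m. scale (c i j) (x i)) - (\<Sum>i=1..m. \<Sum>j=1..m. scale (c i j) (x j))"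
      by (simp add: sum.cartesian_product[symmetric] free.scale_right_diff_distrib sum_subtractf)
    also have "(\<Sum>i=1..m. \<Sum>j=1..m. scale (c i j) (x j)) = (\<Sum>i=1..m. \<Sum>j=1..m. scale (c j i) (x i))"
      by (rule sum.swap)
    also have "(\<Sum>i=1..m. \<Sum>j=1..m. scale (c i j) (x i)) - (\<Sum>i=1..m. \<Sum>j=1..m. scale (c j i) (x i)) =
        (\<Sum>i=1..m. scale ((\<Sum>j=1..m. c i j) - (\<Sum>j=1..m. c j i)) (x i))"
      by (simp add: free.scale_left_diff_distrib free.scale_sum_left sum_subtractf)
    \<comment> \<open>Indices beyond \<open>n\<close> drop out because \<open>x i = 0\<close> there;
      the remaining ones are those governed by the side conditions.\<close>
    also have "\<dots> = (\<Sum>i=1..n. scale ((\<Sum>j=1..m. c i j) - (\<Sum>j=1..m. c j i)) (x i))"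
      using nm tail by (intro sum.mono_neutral_right) auto
    also have "\<dots> = u" using nf cl by (simp add: normal_form_def)
    finally have u: "u = (\<Sum>p\<in>{1..m} \<times> {1..m}. scale (c (fst p) (snd p)) (x (fst p) - x (snd p)))"
      by (simp add: case_prod_unfold)
    have mem: "x (fst p) \<in> supp u \<and> x (snd p) \<in> supp u" if "p \<in> {1..m} \<times> {1..m}" for p
      using that by (auto simp: sx)
    have ne: "{1..m} \<times> {1..m} \<noteq> {}" using m1 by simp
    show "0 \<le> t \<and> u \<in> ball_on (supp u) t"
      unfolding t case_prod_unfold
      by (intro conjI; rule max_ball_on_supp[OF _ ne]) (use mem u in auto)
  next
    fix r assume r: "0 \<le> r" "u \<in> ball_on (supp u) r"
    obtain c where c: "u = (\<Sum>a\<in>supp u. \<Sum>b\<in>supp u. scale (c a b) (a - b))"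
      "\<And>a b. a \<in> supp u \<Longrightarrow> b \<in> supp u \<Longrightarrow> v (c a b) * d a b \<le> r" using r(2) by (rule ball_onE) blast
    \<comment> \<open>Clearing the diagonal is free: diagonal entries cancel in the balances, and a
      zero entry costs \<open>0 \<le> r\<close>.\<close>
    define C where "C i j = (if i = j then 0 else c (x i) (x j))" for i j
    have "(\<Sum>j=1..m. C i j) - (\<Sum>j=1..m. C j i) = l i" if i: "i \<in> {1..n}" for i
    proof -
      have im: "i \<in> {1..m}" using i nm by auto
      have "l i = coef (x i) (\<Sum>a\<in>supp u. \<Sum>b\<in>supp u. scale (c a b) (a - b))"
        using normal_form_keys(2)[OF nf i] c(1) by simp
      also have "\<dots> = (\<Sum>b\<in>supp u. c (x i) b) - (\<Sum>b\<in>supp u. c b (x i))"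
        using im sx supp_subset by (intro coef_combination) auto
      also have "\<dots> = (\<Sum>j=1..m. c (x i) (x j)) - (\<Sum>j=1..m. c (x j) (x i))"
        unfolding sx sum.reindex[OF inj] comp_def by (rule refl)
      also have "\<dots> = (\<Sum>j=1..m. c (x i) (x j) - c (x j) (x i))" by (simp add: sum_subtractf)
      also have "\<dots> = (\<Sum>j=1..m. C i j - C j i)"
        by (intro sum.cong) (auto simp: C_def)
      finally show ?thesis by (simp add: sum_subtractf)
    qed
    then have "(MAX (i, j)\<in>{1..m} \<times> {1..m}. v (C i j) * d (x i) (x j)) \<in> ?R"
      by (intro CollectI exI[of _ C]) (simp add: C_def)
    moreover have "v (C i j) * d (x i) (x j) \<le> r" if "i \<in> {1..m}" "j \<in> {1..m}" for i j
      using that sx c(2) r(1) by (auto simp: C_def)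
    then have "(MAX (i, j)\<in>{1..m} \<times> {1..m}. v (C i j) * d (x i) (x j)) \<le> r"
      using m1 by (subst Max_le_iff) auto
    ultimately show "\<exists>t\<in>?R. t \<le> r" by blast
  }
qed

end

theorem theorem4p3:
  fixes v :: "'f::field \<Rightarrow> real"
    and d :: "('x \<Rightarrow>\<^sub>0 'f) \<Rightarrow> ('x \<Rightarrow>\<^sub>0 'f) \<Rightarrow> real"
  assumes "nonarch_valuation v"
    and "ultra_pseudometric_on Xbar d"
  shows "(\<exists>p. Kantorovich_ultra_seminorm v d p) \<and>
    (\<forall>p. Kantorovich_ultra_seminorm v d p \<longrightarrow>
      (ultra_metric_on Xbar d \<longrightarrow> ultra_norm v p) \<and>
      (\<forall>u. p u =
        Inf {(MAX i\<in>{1..k}. v (s i) * d (x i) (y i)) | (k::nat) s x y.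
          1 \<le> k \<and> u = (\<Sum>i=1..k. scale (s i) (x i - y i)) \<and>
          (\<forall>i\<in>{1..k}. x i \<in> supp u \<and> y i \<in> supp u)}) \<and>
      (\<forall>u n l x m. normal_form u n l x \<and> m = card (supp u) \<and> supp u = x ` {1..m} \<longrightarrow>
        p u =
        Inf {(MAX (i, j)\<in>{1..m} \<times> {1..m}. v (c i j) * d (x i) (x j)) | c.
          (\<forall>i\<in>{1..m}. c i i = 0) \<and>
          (\<forall>i\<in>{1..n}. (\<Sum>j=1..m. c i j) - (\<Sum>j=1..m. c j i) = l i)}))"
proof -
  interpret ultra_distance v d using assms by unfold_locales
  show ?thesis
    \<comment> \<open>Existence is witnessed by \<open>K_norm\<close>; uniqueness then replaces an
      arbitrary \<open>p\<close> by \<open>K_norm\<close> in the other claims.\<close>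
    by (intro conjI allI impI exI[of _ K_norm] Kantorovich_K_norm; drule Kantorovich_unique; hypsubst;
      (erule ultra_norm_K_norm | rule K_norm_on_support | elim conjE, rule K_norm_transport; assumption))
qed

end
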